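(* Let $(N_1,m_1)\vartriangleright_E(N_2,m_2)$ and let $G$ be a well-formed TFG for this equivalence. For every marking $m_1'$ of $N_1$, $m_1'\in R(N_1,m_1)$ if and only if there exists a total, well-defined configuration $c$ of $G$ with $c\equiv m_1'$ and $c_{|N_2}\in R(N_2,m_2)$. (Thus deciding whether $m_1'$ is reachable in $(N_1,m_1)$ amounts to constructing the total, well-defined configuration $c\equiv m_1'$, if any, and checking whether $c_{|N_2}$ is reachable in $(N_2,m_2)$.)
   Context: A Petri net $N=(P,T,\mathrm{Pre},\mathrm{Post})$ has a finite set of places $P$, a finite set of transitions $T$, and flow functions $\mathrm{Pre},\mathrm{Post}:T\to(P\to\mathbb{N})$. A marking is $m:P\to\mathbb{N}$; $t$ is enabled at $m$ if $m\ge\mathrm{Pre}(t)$, and firing gives $m-\mathrm{Pre}(t)+\mathrm{Post}(t)$. $R(N,m_0)$ is the set of markings reachable from $m_0$ by finite (possibly empty) firing sequences. Linear systems: $E$ is a finite collection of equations $x=y_1+\dots+y_l$, with variable set $\mathrm{fv}(E)$; solutions are non-negative integer; consistent means having a solution. For a partial map $c$ defined exactly on $v_1,\dots,v_k$, $[c]$ is the system $v_1=c(v_1),\dots,v_k=c(v_k)$; commas denote union. $E$-equivalence: $(N_1,m_1)\vartriangleright_E(N_2,m_2)$ (place sets $P_1,P_2$) iff (A1) $E,[m]$ consistent for every $m\in R(N_1,m_1)\cup R(N_2,m_2)$; (A2) $E,[m_1],[m_2]$ consistent; (A3) for all markings $m_1'$ of $N_1$, $m_2'$ of $N_2$ with $E,[m_1'],[m_2']$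 consistent, $m_1'\in R(N_1,m_1)\iff m_2'\in R(N_2,m_2)$. TFGs: fix pairwise disjoint sets $K(n)$, $n\in\mathbb{N}$, of constant nodes of value $n$, disjoint from place/variable names; $K=\bigcup_nK(n)$. A TFG with places $P$ is $(V,R,A)$, $V=P\cup S$ with $S\subset K$ finite, $R,A\subseteq V\times V$ disjoint; $v\mathbin{\to\!\bullet} w$ iff $(v,w)\in R$, $v\mathbin{\circ\!\to} w$ iff $(v,w)\in A$, $v\to w$ for either. Roots have no incoming arc; $\circ$-leaves have no outgoing $A$-arc. $v\mathbin{\circ\!\to} X$: $X$ is the nonempty set of all $A$-successors of $v$; $X\mathbin{\to\!\bullet} v$: $X$ is the nonempty set of all $R$-predecessors of $v$. Well-formed TFG for $(N_1,m_1)\vartriangleright_E(N_2,m_2)$: (T1) $V\setminus K=P_1\cup P_2\cup\mathrm{fv}(E)$; (T2) nodes in $V\cap K$ are roots; (T3) not both $p\mathbin{\circ\!\to} q$ and $p'\to q$ with $p\ne p'$, and not both $p\mathbin{\to\!\bullet} q$ and $p\mathbin{\circ\!\to} q$; (T4) $v\mathbin{\circ\!\to} X$ or $X\mathbin{\to\!\bullet} v$ iff the equation $v=\sum_{x\in X}x$ is in $E$; (T5) acyclic; (T6) roots not in $K$ are exactly $P_2$, $\circ$-leaves not in $K$ exactly $P_1$. A configuration is a partial $c:V\to\mathbb{N}$ ($\bot$ where undefined) with $c(v)=n$ for $v\in V\cap K(n)$; total if defined everywhere; $c_{|N}$ is its restriction to the places of $N$. For a marking $m$, $c\equiv m$ means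 $c(p)=m(p)$ for all places $p$ where both are defined. $c$ is well-defined if (CBot) whenever $v\to w$, $c(v)=\bot\iff c(w)=\bot$; (CEq) whenever $c(v)\ne\bot$ and ($v\mathbin{\circ\!\to} X$ or $X\mathbin{\to\!\bullet} v$), $c(v)=\sum_{x\in X}c(x)$. *)

theory Defs
  imports Main "HOL-Library.Multiset" "HOL-Library.Disjoint_Sets"
begin

section \<open>Petri nets\<close>

record ('v, 't) petri_net =
  places :: "'v set"
  transitions :: "'t set"
  Pre :: "'t \<Rightarrow> 'v \<Rightarrow> nat"
  Post :: "'t \<Rightarrow> 'v \<Rightarrow> nat"

definition is_petri_net :: "('v, 't) petri_net \<Rightarrow> bool" where
  "is_petri_net N \<longleftrightarrow> finite (places N) \<and> finite (transitions N)"

text \<open>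
  A function from the places of a net to the naturals is a map whose domain is the set of places.
  Values of \<open>Pre\<close> and \<open>Post\<close> outside the places of the net are never used.
\<close>

definition marking :: "('v, 't) petri_net \<Rightarrow> ('v \<rightharpoonup> nat) \<Rightarrow> bool" where
  "marking N m \<longleftrightarrow> dom m = places N"

definition enabled :: "('v, 't) petri_net \<Rightarrow> ('v \<rightharpoonup> nat) \<Rightarrow> 't \<Rightarrow> bool" where
  "enabled N m t \<longleftrightarrow> t \<in> transitions N \<and> (\<forall>p\<in>places N. Pre N t p \<le> the (m p))"

definition fire :: "('v, 't) petri_net \<Rightarrow> 't \<Rightarrow> ('v \<rightharpoonup> nat) \<Rightarrow> ('v \<rightharpoonup> nat)" where
  "fire N t m = (\<lambda>p. if p \<in> places N then Some (the (m p) - Pre N t p + Post N t p) else None)"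

definition reachable :: "('v, 't) petri_net \<Rightarrow> ('v \<rightharpoonup> nat) \<Rightarrow> ('v \<rightharpoonup> nat) set" where
  "reachable N m0 = {m. (m0, m) \<in> {(m', fire N t m') | m' t. enabled N m' t}\<^sup>*}"


section \<open>Linear systems\<close>

text \<open>
  Throughout, \<open>K n\<close> is the set of constant nodes of value \<open>n\<close>. Constant nodes may occur on either
  side of an equation; they are not variables, and every solution gives them their value.
  \<open>Sum_Eq x Y\<close> is the equation of \<open>x\<close> with the sum of \<open>Y\<close>; as \<open>Y\<close> is a multiset, repeated summands
  are allowed and the order of summands is irrelevant. \<open>Val_Eq x n\<close> equates \<open>x\<close> with a number and is
  only used for the systems \<open>[c]\<close>.
\<close>

datatype 'v equation = Sum_Eq 'v "'v multiset" | Val_Eq 'v nat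

definition linear_system :: "'v equation set \<Rightarrow> bool" where
  "linear_system E \<longleftrightarrow> finite E \<and> (\<forall>e\<in>E. \<exists>x Y. Y \<noteq> {#} \<and> e = Sum_Eq x Y)"

definition constants :: "(nat \<Rightarrow> 'v set) \<Rightarrow> 'v set" where
  "constants K = (\<Union>n. K n)"

fun eq_symbols :: "'v equation \<Rightarrow> 'v set" where
  "eq_symbols (Sum_Eq x Y) = insert x (set_mset Y)"
| "eq_symbols (Val_Eq x n) = {x}"

definition fv :: "(nat \<Rightarrow> 'v set) \<Rightarrow> 'v equation set \<Rightarrow> 'v set" where
  "fv K E = (\<Union>e\<in>E. eq_symbols e) - constants K"

fun satisfies :: "('v \<Rightarrow> nat) \<Rightarrow> 'v equation \<Rightarrow> bool" where
  "satisfies s (Sum_Eq x Y) \<longleftrightarrow> s x = (\<Sum>y\<in>#Y. s y)"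
| "satisfies s (Val_Eq x n) \<longleftrightarrow> s x = n"

definition solution :: "(nat \<Rightarrow> 'v set) \<Rightarrow> 'v equation set \<Rightarrow> ('v \<Rightarrow> nat) \<Rightarrow> bool" where
  "solution K E s \<longleftrightarrow> (\<forall>n. \<forall>k\<in>K n. s k = n) \<and> (\<forall>e\<in>E. satisfies s e)"

definition consistent :: "(nat \<Rightarrow> 'v set) \<Rightarrow> 'v equation set \<Rightarrow> bool" where
  "consistent K E \<longleftrightarrow> (\<exists>s. solution K E s)"

definition system_of :: "('v \<rightharpoonup> nat) \<Rightarrow> 'v equation set" where
  "system_of c = {Val_Eq v n | v n. c v = Some n}"


section \<open>E-equivalence\<close>

definition E_equivalent ::
  "(nat \<Rightarrow> 'v set) \<Rightarrow> 'v equation set \<Rightarrow>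
   ('v, 't1) petri_net \<Rightarrow> ('v \<rightharpoonup> nat) \<Rightarrow> ('v, 't2) petri_net \<Rightarrow> ('v \<rightharpoonup> nat) \<Rightarrow> bool" where
  "E_equivalent K E N1 m1 N2 m2 \<longleftrightarrow>
     (\<forall>m \<in> reachable N1 m1 \<union> reachable N2 m2. consistent K (E \<union> system_of m)) \<and>
     consistent K (E \<union> system_of m1 \<union> system_of m2) \<and>
     (\<forall>m1' m2'. marking N1 m1' \<longrightarrow> marking N2 m2' \<longrightarrow>
        consistent K (E \<union> system_of m1' \<union> system_of m2') \<longrightarrow>
        (m1' \<in> reachable N1 m1 \<longleftrightarrow> m2' \<in> reachable N2 m2))"


section \<open>Token flow graphs\<close>

record 'v tfg =
  nodes :: "'v set"
  R_arcs :: "('v \<times> 'v) set"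
  A_arcs :: "('v \<times> 'v) set"

definition is_tfg :: "(nat \<Rightarrow> 'v set) \<Rightarrow> 'v set \<Rightarrow> 'v tfg \<Rightarrow> bool" where
  "is_tfg K P G \<longleftrightarrow>
     P \<inter> constants K = {} \<and>
     (\<exists>S. finite S \<and> S \<subseteq> constants K \<and> nodes G = P \<union> S) \<and>
     R_arcs G \<subseteq> nodes G \<times> nodes G \<and> A_arcs G \<subseteq> nodes G \<times> nodes G \<and>
     R_arcs G \<inter> A_arcs G = {}"

abbreviation arcs :: "'v tfg \<Rightarrow> ('v \<times> 'v) set" where
  "arcs G \<equiv> R_arcs G \<union> A_arcs G"

definition roots :: "'v tfg \<Rightarrow> 'v set" where
  "roots G = {v \<in> nodes G. \<nexists>u. (u, v) \<in> arcs G}"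

definition A_leaves :: "'v tfg \<Rightarrow> 'v set" where
  "A_leaves G = {v \<in> nodes G. \<nexists>w. (v, w) \<in> A_arcs G}"

text \<open>\<open>A_successors G v X\<close> is \<open>v \<circ>\<rightarrow> X\<close> and \<open>R_predecessors G X v\<close> is \<open>X \<rightarrow>\<bullet> v\<close>.\<close>

definition A_successors :: "'v tfg \<Rightarrow> 'v \<Rightarrow> 'v set \<Rightarrow> bool" where
  "A_successors G v X \<longleftrightarrow> X \<noteq> {} \<and> X = {w. (v, w) \<in> A_arcs G}"

definition R_predecessors :: "'v tfg \<Rightarrow> 'v set \<Rightarrow> 'v \<Rightarrow> bool" where
  "R_predecessors G X v \<longleftrightarrow> X \<noteq> {} \<and> X = {u. (u, v) \<in> R_arcs G}"

text \<open>
  The clause on equations ranges over all right-hand sides, so \<open>E\<close> consists exactly of the equations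
  read off the graph; in particular it then has no equation with a repeated summand.
\<close>

definition well_formed ::
  "(nat \<Rightarrow> 'v set) \<Rightarrow> 'v equation set \<Rightarrow>
   ('v, 't1) petri_net \<Rightarrow> ('v, 't2) petri_net \<Rightarrow> 'v tfg \<Rightarrow> bool" where
  "well_formed K E N1 N2 G \<longleftrightarrow>
     nodes G - constants K = places N1 \<union> places N2 \<union> fv K E \<and>
     nodes G \<inter> constants K \<subseteq> roots G \<and>
     (\<forall>p p' q. p \<noteq> p' \<longrightarrow> \<not> ((p, q) \<in> A_arcs G \<and> (p', q) \<in> arcs G)) \<and>
     (\<forall>p q. \<not> ((p, q) \<in> R_arcs G \<and> (p, q) \<in> A_arcs G)) \<and>
     (\<forall>v Y. (\<exists>X. (A_successors G v X \<or> R_predecessors G X v) \<and> Y = mset_set X) \<longleftrightarrow>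
        Sum_Eq v Y \<in> E) \<and>
     acyclic (arcs G) \<and>
     roots G - constants K = places N2 \<and>
     A_leaves G - constants K = places N1"


section \<open>Configurations\<close>

definition configuration :: "(nat \<Rightarrow> 'v set) \<Rightarrow> 'v tfg \<Rightarrow> ('v \<rightharpoonup> nat) \<Rightarrow> bool" where
  "configuration K G c \<longleftrightarrow> dom c \<subseteq> nodes G \<and> (\<forall>n. \<forall>v \<in> nodes G \<inter> K n. c v = Some n)"

definition total_config :: "'v tfg \<Rightarrow> ('v \<rightharpoonup> nat) \<Rightarrow> bool" where
  "total_config G c \<longleftrightarrow> (\<forall>v \<in> nodes G. c v \<noteq> None)"

definition compatible :: "('v \<rightharpoonup> nat) \<Rightarrow> ('v \<rightharpoonup> nat) \<Rightarrow> bool" where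
  "compatible c m \<longleftrightarrow> (\<forall>p \<in> dom c \<inter> dom m. c p = m p)"

text \<open>By the first clause, all summands in the second clause are defined.\<close>

definition well_defined :: "'v tfg \<Rightarrow> ('v \<rightharpoonup> nat) \<Rightarrow> bool" where
  "well_defined G c \<longleftrightarrow>
     (\<forall>(v, w) \<in> arcs G. c v = None \<longleftrightarrow> c w = None) \<and>
     (\<forall>v X. c v \<noteq> None \<longrightarrow> A_successors G v X \<or> R_predecessors G X v \<longrightarrow>
        c v = Some (\<Sum>x\<in>X. the (c x)))"

end

theory Submission
  imports Defs
begin

text \<open>
  The total, well-defined configurations of \<open>G\<close> are the restrictions to its nodes of the solutions
  of \<open>E\<close>. So if \<open>m1'\<close> is reachable, a solution of \<open>E, [m1']\<close> given by (A1) yields \<open>c\<close>; conversely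
  \<open>c\<close>, extended to the constants outside \<open>G\<close>, solves \<open>E, [m1'], [c|N2]\<close>. Either way (A3) transfers
  reachability between \<open>m1'\<close> and \<open>c|N2\<close>.
\<close>

lemma solution_Un_system_of:
  "solution K (E \<union> system_of m) s \<longleftrightarrow> solution K E s \<and> (\<forall>v n. m v = Some n \<longrightarrow> s v = n)"
  unfolding solution_def system_of_def ball_Un by force

lemma well_formed_nodes:
  assumes "well_formed K E N1 N2 G"
  shows "places N1 \<subseteq> nodes G" "places N2 \<subseteq> nodes G"
  using assms unfolding well_formed_def by auto

lemma successors_in_nodes:
  assumes "is_tfg K P G" and "A_successors G v X \<or> R_predecessors G X v"
  shows "v \<in> nodes G" "X \<subseteq> nodes G"
  using assms unfolding is_tfg_def A_successors_def R_predecessors_def by auto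

text \<open>The clause of \<open>well_formed\<close> on equations makes \<open>E\<close> exactly the
  set of equations read off the graph: \<open>linear_system\<close> rules out \<open>Val_Eq\<close>,
  so every member of \<open>E\<close> arises in this way.\<close>

lemma satisfies_system_iff:
  assumes lin: "linear_system E" and wf: "well_formed K E N1 N2 G"
  shows "(\<forall>e\<in>E. satisfies s e) \<longleftrightarrow>
    (\<forall>v X. A_successors G v X \<or> R_predecessors G X v \<longrightarrow> s v = sum s X)"
proof -
  have eq: "Sum_Eq v Y \<in> E \<longleftrightarrow>
      (\<exists>X. (A_successors G v X \<or> R_predecessors G X v) \<and> Y = mset_set X)" for v Y
    using wf unfolding well_formed_def by metis
  have form: "\<exists>x Y. Y \<noteq> {#} \<and> e = Sum_Eq x Y" if "e \<in> E" for e
    using lin that unfolding linear_system_def by blast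
  show ?thesis
  proof (intro iffI allI impI ballI)
    fix v X assume sat: "\<forall>e\<in>E. satisfies s e"
      and X: "A_successors G v X \<or> R_predecessors G X v"
    have "Sum_Eq v (mset_set X) \<in> E" using eq X by blast
    \<comment> \<open>Rewriting with \<open>sum_unfold_sum_mset\<close> needs no finiteness of
      \<open>X\<close>: for infinite \<open>X\<close>, \<open>mset_set X\<close> is empty and both
      sums are 0.\<close>
    then show "s v = sum s X" using sat by (fastforce simp: sum_unfold_sum_mset)
  next
    fix e assume sums: "\<forall>v X. A_successors G v X \<or> R_predecessors G X v \<longrightarrow> s v = sum s X"
      and e: "e \<in> E"
    from form[OF e] obtain v Y where e_eq: "e = Sum_Eq v Y" by blast
    then obtain X where X: "A_successors G v X \<or> R_predecessors G X v" "Y = mset_set X"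
      using e eq by blast
    then have "s v = sum s X" using sums by blast
    then show "satisfies s e" using e_eq X by (simp add: sum_unfold_sum_mset)
  qed
qed

text \<open>Arcs join nodes, and \<open>c\<close> is defined on all nodes. So the condition on
  undefined values holds trivially, the guard of the sum condition is always met, and what remains
  is the sum condition for \<open>s\<close>.\<close>

lemma well_defined_total_iff:
  assumes tfg: "is_tfg K P G" and lin: "linear_system E" and wf: "well_formed K E N1 N2 G"
    and c: "\<And>v. v \<in> nodes G \<Longrightarrow> c v = Some (s v)"
  shows "well_defined G c \<longleftrightarrow> (\<forall>e\<in>E. satisfies s e)"
proof -
  have sums: "(\<Sum>x\<in>X. the (c x)) = sum s X" if "A_successors G v X \<or> R_predecessors G X v" for v X
    using successors_in_nodes(2)[OF tfg that] c by (intro sum.cong) auto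
  have "c v = Some (\<Sum>x\<in>X. the (c x)) \<longleftrightarrow> s v = sum s X"
    if "A_successors G v X \<or> R_predecessors G X v" for v X
    using sums[OF that] c[OF successors_in_nodes(1)[OF tfg that]] by simp
  moreover have "c v \<noteq> None" if "A_successors G v X \<or> R_predecessors G X v" for v X
    using c[OF successors_in_nodes(1)[OF tfg that]] by simp
  moreover have "c v \<noteq> None" "c w \<noteq> None" if "(v, w) \<in> arcs G" for v w
    using tfg that c unfolding is_tfg_def by blast+
  ultimately show ?thesis
    unfolding satisfies_system_iff[OF lin wf] well_defined_def by blast
qed

text \<open>A solution must give every constant its value, also those that are not nodes, where
  \<open>c\<close> says nothing. Disjointness of the sets \<open>K n\<close> makes that value
  unique.\<close>

lemma configuration_extends:
  assumes K: "disjoint_family K" and c: "configuration K G c" and tot: "total_config G c"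
  obtains s where "\<And>v. v \<in> nodes G \<Longrightarrow> c v = Some (s v)" "\<forall>n. \<forall>k\<in>K n. s k = n"
proof
  \<comment> \<open>Outside the graph only the values at constants matter; any other symbol gets an
    arbitrary number.\<close>
  define s where "s v = (if v \<in> nodes G then the (c v) else (THE n. v \<in> K n))" for v
  show "c v = Some (s v)" if "v \<in> nodes G" for v
    using that tot unfolding s_def total_config_def by auto
  show "\<forall>n. \<forall>k\<in>K n. s k = n"
  proof (intro allI ballI)
    fix n k assume k: "k \<in> K n"
    then have "(THE n. k \<in> K n) = n"
      using K unfolding disjoint_family_on_def by (intro the_equality) auto
    then show "s k = n"
      using k c unfolding s_def configuration_def by auto
  qed
qed

theorem theorem2:
  fixes K :: "nat \<Rightarrow> 'v set"
    and N1 :: "('v, 't1) petri_net" and N2 :: "('v, 't2) petri_net"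
    and m1 m2 m1' :: "'v \<rightharpoonup> nat"
    and E :: "'v equation set"
    and P :: "'v set" and G :: "'v tfg"
  assumes "disjoint_family K"
    and "is_petri_net N1" and "is_petri_net N2"
    and "places N1 \<inter> constants K = {}" and "places N2 \<inter> constants K = {}"
    and "marking N1 m1" and "marking N2 m2"
    and "linear_system E"
    and "E_equivalent K E N1 m1 N2 m2"
    and "is_tfg K P G" and "well_formed K E N1 N2 G"
    and "marking N1 m1'"
  shows "m1' \<in> reachable N1 m1 \<longleftrightarrow>
    (\<exists>c. configuration K G c \<and> total_config G c \<and> well_defined G c \<and> compatible c m1' \<and>
         c |` places N2 \<in> reachable N2 m2)"
proof -
  note K = assms(1) and lin = assms(8) and equiv = assms(9) and tfg = assms(10) and wf = assms(11)
    and m1' = assms(12)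
  note nodes = well_formed_nodes[OF wf]
  have transfer: "m1' \<in> reachable N1 m1 \<longleftrightarrow> c |` places N2 \<in> reachable N2 m2"
    if c: "\<And>v. v \<in> nodes G \<Longrightarrow> c v = Some (s v)"
      and sol: "solution K (E \<union> system_of m1') s" for c s
  proof -
    have "marking N2 (c |` places N2)"
      using c nodes unfolding marking_def by (auto simp: restrict_map_def split: if_splits)
    moreover have "solution K (E \<union> system_of m1' \<union> system_of (c |` places N2)) s"
      unfolding solution_Un_system_of[of _ _ "c |` places N2"]
      using sol c nodes by (auto simp: restrict_map_def split: if_splits)
    ultimately show ?thesis
      using equiv m1' unfolding E_equivalent_def consistent_def by blast
  qed
  show ?thesis
  proof
    assume reach: "m1' \<in> reachable N1 m1"
    then obtain s where s: "solution K (E \<union> system_of m1') s"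
      using equiv unfolding E_equivalent_def consistent_def by blast
    \<comment> \<open>The marking of \<open>N2\<close> is not chosen separately: it is read off from
      the same solution \<open>s\<close>.\<close>
    define c where "c v = (if v \<in> nodes G then Some (s v) else None)" for v
    have c: "c v = Some (s v)" if "v \<in> nodes G" for v
      using that by (simp add: c_def)
    have "configuration K G c"
      using s unfolding configuration_def c_def solution_def by (auto split: if_splits)
    moreover have "total_config G c"
      unfolding total_config_def using c by simp
    moreover have "well_defined G c"
      using well_defined_total_iff[OF tfg lin wf, of c s] c s unfolding solution_def by blast
    moreover have "compatible c m1'"
      using s unfolding compatible_def solution_Un_system_of c_def by (auto split: if_splits)
    moreover have "c |` places N2 \<in> reachable N2 m2"
      using transfer[OF c s] reach by blast
    ultimately show "\<exists>c. configuration K G c \<and> total_config G c \<and> well_defined G c \<and>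
        compatible c m1' \<and> c |` places N2 \<in> reachable N2 m2"
      by blast
  next
    assume "\<exists>c. configuration K G c \<and> total_config G c \<and> well_defined G c \<and>
        compatible c m1' \<and> c |` places N2 \<in> reachable N2 m2"
    then obtain c where conf: "configuration K G c" "total_config G c" and wd: "well_defined G c"
      and comp: "compatible c m1'" and reach: "c |` places N2 \<in> reachable N2 m2" by blast
    obtain s where c: "\<And>v. v \<in> nodes G \<Longrightarrow> c v = Some (s v)" and s: "\<forall>n. \<forall>k\<in>K n. s k = n"
      using configuration_extends[OF K conf] by blast
    have "solution K E s"
      using well_defined_total_iff[OF tfg lin wf, of c s] c s wd unfolding solution_def by blast
    \<comment> \<open>Places of \<open>N1\<close> are nodes, so compatibility makes
      \<open>s\<close>, \<open>c\<close> and \<open>m1'\<close> agree on them.\<close>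
    moreover have "s v = n" if "m1' v = Some n" for v n
    proof -
      have "v \<in> nodes G" using that m1' nodes unfolding marking_def by blast
      then have "c v = Some (s v)" by (rule c)
      with that comp show ?thesis unfolding compatible_def by force
    qed
    ultimately have "solution K (E \<union> system_of m1') s"
      unfolding solution_Un_system_of by blast
    from transfer[OF c this] reach show "m1' \<in> reachable N1 m1" by blast
  qed
qed

end
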